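(* Let $p\ge1$ be an integer, $f\in L^1(\mathbb R^2,\mathbb H)\cap L^{p}(\mathbb{R}^{2},\mathbb{H})$ and $g\in L^{1}(\mathbb{R}^{2},\mathbb{H})$, and write $f=f_{a}+\nu\overline{f_{b}}$, $g=g_{a}+\nu\overline{g_{b}}$ with $f_{a},f_{b},g_{a},g_{b}$ taking values in $\mathbb{H}(\mu)$. Put $\tilde A_i=\begin{pmatrix}a_i&b_i\\ \frac{c_i}{2}-\frac{1}{2b_i}&\frac{d_i}{2}\end{pmatrix}$ for $i=1,2$, and write $\mathcal L^{\mu,\pm\mu}=\mathcal L^{\mu,\pm\mu}_{A_1,A_2}$. Then for all $(u,v)\in\mathbb R^2$ $$\begin{aligned}\mathcal{L}^{\mu,\mu}[f\circledcirc_{A_{1},A_{2}} g](u,v)={}&e^{-\mu(\frac{d_{1}}{2b_{1}}u^2+\frac{d_{2}}{2b_{2}}v^2)}\big(\mathcal{L}^{\mu,\mu}[\overline{f_{a}}](-u,-v)\mathcal{L}^{\mu,\mu}[g_{a}](u,v)+\mathcal{L}^{\mu,\mu}[f_{b}](-u,-v)\mathcal{L}^{\mu,\mu}[\overline{g_{b}}](u,v)\big)\\&-e^{-\mu(\frac{d_{1}}{2b_{1}}u^2-\frac{d_{2}}{2b_{2}}v^2)}\big(\mathcal{L}^{\mu,-\mu}[f_{b}](-u,-v)\mathcal{L}^{\mu,-\mu}[\overline{g_{a}}](u,v)-\mathcal{L}^{\mu,-\mu}[\overline{f_{a}}](-u,-v)\mathcal{L}^{\mu,-\mu}[g_{b}](u,v)\big)\nu\end{aligned}$$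 and $$\begin{aligned}\mathcal{L}^{\mu,\mu}[f\circledcirc_{A_{1},A_{2}} g](u,v)={}&\big(\mathcal{L}_{\tilde{A}_{1},\tilde{A}_{2}}^{\mu,\mu}[\overline{f_{a}}](-u,-v)\mathcal{L}_{\tilde{A}_{1},\tilde{A}_{2}}^{\mu,\mu}[g_{a}](u,v)+\mathcal{L}_{\tilde{A}_{1},\tilde{A}_{2}}^{\mu,\mu}[f_{b}](-u,-v)\mathcal{L}_{\tilde{A}_{1},\tilde{A}_{2}}^{\mu,\mu}[\overline{g_{b}}](u,v)\big)\\&-\big(\mathcal{L}^{\mu,-\mu}_{\tilde{A}_{1},\tilde{A}_{2}}[f_{b}](-u,-v)\mathcal{L}^{\mu,-\mu}_{\tilde{A}_{1},\tilde{A}_{2}}[\overline{g_{a}}](u,v)-\mathcal{L}^{\mu,-\mu}_{\tilde{A}_{1},\tilde{A}_{2}}[\overline{f_{a}}](-u,-v)\mathcal{L}^{\mu,-\mu}_{\tilde{A}_{1},\tilde{A}_{2}}[g_{b}](u,v)\big)\nu .\end{aligned}$$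
   Context: $\mathbb H=\{q_r+\mu q_\mu+\nu q_\nu+\eta q_\eta\}$ is the quaternion algebra with $\mu^2=\nu^2=\eta^2=\mu\nu\eta=-1$, $\mu\nu=-\nu\mu=\eta$, conjugation $\overline q=q_r-\mu q_\mu-\nu q_\nu-\eta q_\eta$, and modulus $|q|=\sqrt{q\overline q}$. $\mathbb H(\mu)=\{q_r+\mu q_\mu:q_r,q_\mu\in\mathbb R\}$. Every $f:\mathbb R^2\to\mathbb H$ can be written uniquely as $f=f_a+f_b\nu=f_a+\nu\overline{f_b}$ with $f_a,f_b$ valued in $\mathbb H(\mu)$. $L^p(\mathbb R^2,\mathbb H)$ is the space of $f:\mathbb R^2\to\mathbb H$ with $\|f\|_p=(\int_{\mathbb R^2}|f|^p\,dx\,dy)^{1/p}<\infty$. $A_i=\begin{pmatrix}a_i&b_i\\c_i&d_i\end{pmatrix}$, $i=1,2$, are real matrices with $a_id_i-b_ic_i=1$ and $b_i\neq0$. For $\lambda\in\{\mu,-\mu\}$ and such a matrix $A=\begin{pmatrix}a&b\\c&d\end{pmatrix}$, $$K_A^{\lambda}(x,u)=\frac{1}{\sqrt{2\pi b\lambda}}\,e^{\lambda(\frac{a}{2b}x^2-\frac1b xu+\frac{d}{2b}u^2)},\qquad W_A^\lambda(t,\tau)=\frac{1}{\sqrt{2\pi b\lambda}}\,e^{\lambda\tau(\tau-t)\frac ab},$$ with the principal square root in $\mathbb H(\mu)\cong\mathbb C$. For $f\in L^1(\mathbb R^2,\mathbb H)$, $\mathcal L^{\mu,\pm\mu}_{A_1,A_2}[f](u,v)=\int_{\mathbb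 R^2}K^{\mu}_{A_1}(x,u)f(x,y)K^{\pm\mu}_{A_2}(y,v)\,dx\,dy$ (and likewise with $\tilde A_i$, which also have determinant $1$). The correlation operator is $$(f\circledcirc_{A_1,A_2} g)(x,y)=\int_{\mathbb R^2}W_{A_1}^{\mu}(x,\tau_1)\overline{f(-\tau_1,-\tau_2)}\,g(x-\tau_1,y-\tau_2)W_{A_2}^{\mu}(y,\tau_2)\,d\tau_1d\tau_2 .$$ *)

theory Defs
  imports "HOL-Analysis.Analysis"
begin

section \<open>The quaternion algebra\<close>

codatatype quat = Quat (re_part: real) (mu_part: real) (nu_part: real) (eta_part: real)

lemma quat_eqI:
  "re_part p = re_part q \<Longrightarrow> mu_part p = mu_part q \<Longrightarrow> nu_part p = nu_part q \<Longrightarrow>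
   eta_part p = eta_part q \<Longrightarrow> p = q"
  by (rule quat.expand) simp

lemma quat_eq_iff:
  "p = q \<longleftrightarrow> re_part p = re_part q \<and> mu_part p = mu_part q \<and> nu_part p = nu_part q \<and>
     eta_part p = eta_part q"
  by (auto intro: quat_eqI)

instantiation quat :: ab_group_add
begin

primcorec zero_quat where
  "re_part 0 = 0"
| "mu_part 0 = 0"
| "nu_part 0 = 0"
| "eta_part 0 = 0"

primcorec plus_quat where
  "re_part (p + q) = re_part p + re_part q"
| "mu_part (p + q) = mu_part p + mu_part q"
| "nu_part (p + q) = nu_part p + nu_part q"
| "eta_part (p + q) = eta_part p + eta_part q"

primcorec uminus_quat where
  "re_part (- q) = - re_part q"
| "mu_part (- q) = - mu_part q"
| "nu_part (- q) = - nu_part q"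
| "eta_part (- q) = - eta_part q"

primcorec minus_quat where
  "re_part (p - q) = re_part p - re_part q"
| "mu_part (p - q) = mu_part p - mu_part q"
| "nu_part (p - q) = nu_part p - nu_part q"
| "eta_part (p - q) = eta_part p - eta_part q"

instance
  by standard (simp_all add: quat_eq_iff)

end

instantiation quat :: ring_1
begin

primcorec one_quat where
  "re_part 1 = 1"
| "mu_part 1 = 0"
| "nu_part 1 = 0"
| "eta_part 1 = 0"

primcorec times_quat where
  "re_part (p * q) = re_part p * re_part q - mu_part p * mu_part q
     - nu_part p * nu_part q - eta_part p * eta_part q"
| "mu_part (p * q) = re_part p * mu_part q + mu_part p * re_part q
     + nu_part p * eta_part q - eta_part p * nu_part q"
| "nu_part (p * q) = re_part p * nu_part q - mu_part p * eta_part q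
     + nu_part p * re_part q + eta_part p * mu_part q"
| "eta_part (p * q) = re_part p * eta_part q + mu_part p * nu_part q
     - nu_part p * mu_part q + eta_part p * re_part q"

instance
  by standard (simp_all add: quat_eq_iff algebra_simps)

end

instantiation quat :: real_algebra_1
begin

primcorec scaleR_quat where
  "re_part (scaleR r q) = r * re_part q"
| "mu_part (scaleR r q) = r * mu_part q"
| "nu_part (scaleR r q) = r * nu_part q"
| "eta_part (scaleR r q) = r * eta_part q"

instance
  by standard (simp_all add: quat_eq_iff algebra_simps)

end

instantiation quat :: real_inner
begin

definition inner_quat :: "quat \<Rightarrow> quat \<Rightarrow> real" where
  "inner_quat p q = re_part p * re_part q + mu_part p * mu_part q
     + nu_part p * nu_part q + eta_part p * eta_part q"

definition norm_quat :: "quat \<Rightarrow> real" where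
  "norm_quat q = sqrt ((re_part q)\<^sup>2 + (mu_part q)\<^sup>2 + (nu_part q)\<^sup>2 + (eta_part q)\<^sup>2)"

definition sgn_quat :: "quat \<Rightarrow> quat" where
  "sgn_quat q = q /\<^sub>R norm q"

definition dist_quat :: "quat \<Rightarrow> quat \<Rightarrow> real" where
  "dist_quat p q = norm (p - q)"

definition uniformity_quat :: "(quat \<times> quat) filter" where
  "uniformity_quat = (INF e\<in>{0<..}. principal {(x, y). dist x y < e})"

definition open_quat :: "quat set \<Rightarrow> bool" where
  "open_quat U \<longleftrightarrow> (\<forall>x\<in>U. eventually (\<lambda>(x', y). x' = x \<longrightarrow> y \<in> U) uniformity)"

instance
proof
  fix p q s :: quat and r :: real
  show "inner p q = inner q p"
    by (simp add: inner_quat_def mult.commute)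
  show "inner (p + q) s = inner p s + inner q s"
    by (simp add: inner_quat_def algebra_simps)
  show "inner (scaleR r p) q = r * inner p q"
    by (simp add: inner_quat_def algebra_simps)
  show "0 \<le> inner p p"
    by (simp add: inner_quat_def)
  show "inner p p = 0 \<longleftrightarrow> p = 0"
    by (simp add: inner_quat_def quat_eq_iff add_nonneg_eq_0_iff)
  show "norm p = sqrt (inner p p)"
    by (simp add: inner_quat_def norm_quat_def power2_eq_square)
qed (rule sgn_quat_def dist_quat_def open_quat_def uniformity_quat_def)+

end

instantiation quat :: real_normed_div_algebra
begin

definition inverse_quat :: "quat \<Rightarrow> quat" where
  "inverse_quat q =
     Quat (re_part q) (- mu_part q) (- nu_part q) (- eta_part q) /\<^sub>R (norm q)\<^sup>2"

definition divide_quat :: "quat \<Rightarrow> quat \<Rightarrow> quat" where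
  "divide_quat p q = p * inverse q"

instance
proof
  fix p q :: quat
  {
    assume "p \<noteq> 0"
    define c where "c = inverse ((norm p)\<^sup>2)"
    have "(norm p)\<^sup>2 = re_part p * re_part p + mu_part p * mu_part p + nu_part p * nu_part p
            + eta_part p * eta_part p"
      by (simp add: norm_quat_def power2_eq_square)
    moreover have "c * (norm p)\<^sup>2 = 1"
      using \<open>p \<noteq> 0\<close> by (simp add: c_def)
    ultimately have "c * (re_part p * re_part p + mu_part p * mu_part p + nu_part p * nu_part p
            + eta_part p * eta_part p) = 1"
      by simp
    then show "inverse p * p = 1" "p * inverse p = 1"
      unfolding inverse_quat_def c_def [symmetric]
      by (simp_all add: quat_eq_iff algebra_simps)
  }
  show "p div q = p * inverse q"
    by (rule divide_quat_def)
  show "inverse (0::quat) = 0"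
    by (simp add: inverse_quat_def quat_eq_iff)
  show "norm (p * q) = norm p * norm q"
    unfolding norm_quat_def real_sqrt_mult [symmetric] real_sqrt_eq_iff times_quat.sel
    by algebra
qed

end

instantiation quat :: euclidean_space
begin

definition Basis_quat :: "quat set" where
  "Basis_quat = {Quat 1 0 0 0, Quat 0 1 0 0, Quat 0 0 1 0, Quat 0 0 0 1}"

instance
proof
  fix u v x :: quat
  show "(Basis :: quat set) \<noteq> {}" "finite (Basis :: quat set)"
    by (simp_all add: Basis_quat_def)
  show "inner u v = (if u = v then 1 else 0)" if "u \<in> Basis" "v \<in> Basis"
    using that unfolding Basis_quat_def insert_iff empty_iff
    by (elim disjE) (simp_all add: inner_quat_def)
  show "(\<forall>u\<in>Basis. inner x u = 0) \<longleftrightarrow> x = 0"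
    unfolding Basis_quat_def quat_eq_iff [of x] by (simp add: inner_quat_def)
qed

end

definition qmu :: quat where "qmu = Quat 0 1 0 0"
definition qnu :: quat where "qnu = Quat 0 0 1 0"
definition qeta :: quat where "qeta = Quat 0 0 0 1"

primcorec qcnj :: "quat \<Rightarrow> quat" where
  "re_part (qcnj q) = re_part q"
| "mu_part (qcnj q) = - mu_part q"
| "nu_part (qcnj q) = - nu_part q"
| "eta_part (qcnj q) = - eta_part q"

lemma of_real_quat: "of_real r = Quat r 0 0 0"
  by (simp add: of_real_def quat_eq_iff)

lemma quat_units:
  "qmu * qmu = -1" "qnu * qnu = -1" "qeta * qeta = -1" "qmu * qnu * qeta = -1"
  "qmu * qnu = qeta" "qnu * qmu = - qeta"
  by (simp_all add: quat_eq_iff qmu_def qnu_def qeta_def)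

lemma quat_expand:
  "q = of_real (re_part q) + qmu * of_real (mu_part q) + qnu * of_real (nu_part q)
     + qeta * of_real (eta_part q)"
  by (simp add: quat_eq_iff of_real_quat qmu_def qnu_def qeta_def)

lemma quat_mult_qcnj: "q * qcnj q = of_real ((norm q)\<^sup>2)"
  by (simp add: quat_eq_iff of_real_quat norm_quat_def power2_eq_square)

definition Hmu :: "quat set" where
  "Hmu = {of_real r + qmu * of_real s | r s. True}"

lemma symplectic_decomposition:
  fixes f :: "'a \<Rightarrow> quat"
  shows "\<exists>!h. (\<forall>z. fst (h z) \<in> Hmu) \<and> (\<forall>z. snd (h z) \<in> Hmu) \<and>
           (\<forall>z. f z = fst (h z) + qnu * qcnj (snd (h z)))"
proof (rule ex1I)
  let ?h = "\<lambda>z. (of_real (re_part (f z)) + qmu * of_real (mu_part (f z)),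
                 of_real (nu_part (f z)) + qmu * of_real (eta_part (f z)))"
  show "(\<forall>z. fst (?h z) \<in> Hmu) \<and> (\<forall>z. snd (?h z) \<in> Hmu) \<and>
          (\<forall>z. f z = fst (?h z) + qnu * qcnj (snd (?h z)))"
    by (auto simp: Hmu_def quat_eq_iff of_real_quat qmu_def qnu_def)
  fix h :: "'a \<Rightarrow> quat \<times> quat"
  assume h: "(\<forall>z. fst (h z) \<in> Hmu) \<and> (\<forall>z. snd (h z) \<in> Hmu) \<and>
               (\<forall>z. f z = fst (h z) + qnu * qcnj (snd (h z)))"
  have "q \<in> Hmu \<Longrightarrow> nu_part q = 0 \<and> eta_part q = 0" for q
    by (auto simp: Hmu_def of_real_quat qmu_def)
  with h show "h = ?h"
    by (auto simp: fun_eq_iff prod_eq_iff quat_eq_iff of_real_quat qmu_def qnu_def)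
qed

lemma nu_qcnj_Hmu: "q \<in> Hmu \<Longrightarrow> qnu * qcnj q = q * qnu"
  by (auto simp: Hmu_def quat_eq_iff of_real_quat qmu_def qnu_def)

text \<open>
  Principal square root transported along the identification of \<^term>\<open>Hmu\<close> with the complex
  numbers sending \<^term>\<open>qmu\<close> to \<^term>\<open>\<i>\<close>; the value is meaningful only for arguments
  in \<^term>\<open>Hmu\<close>.
\<close>

definition Hmu_of_complex :: "complex \<Rightarrow> quat" where
  "Hmu_of_complex z = of_real (Re z) + qmu * of_real (Im z)"

definition Hmu_sqrt :: "quat \<Rightarrow> quat" where
  "Hmu_sqrt q = Hmu_of_complex (csqrt (Complex (re_part q) (mu_part q)))"

lemma Hmu_sqrt_square: "q \<in> Hmu \<Longrightarrow> Hmu_sqrt q * Hmu_sqrt q = q"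
proof -
  assume q: "q \<in> Hmu"
  let ?w = "csqrt (Complex (re_part q) (mu_part q))"
  have "?w * ?w = Complex (re_part q) (mu_part q)"
    by (metis power2_csqrt power2_eq_square)
  then have "Re (?w * ?w) = re_part q" "Im (?w * ?w) = mu_part q"
    by (simp_all only: complex.sel)
  moreover have "nu_part q = 0" "eta_part q = 0"
    using q by (auto simp: Hmu_def of_real_quat qmu_def)
  ultimately show ?thesis
    by (simp add: Hmu_sqrt_def Hmu_of_complex_def quat_eq_iff of_real_quat qmu_def algebra_simps)
qed


section \<open>Lebesgue spaces of quaternion-valued functions\<close>

text \<open>Finiteness of the norm, for a measurable function, is integrability of its \<open>p\<close>-th power.\<close>

definition Lspace :: "nat \<Rightarrow> (real \<times> real \<Rightarrow> quat) set" where
  "Lspace p = {f. f \<in> borel_measurable lebesgue \<and> integrable lebesgue (\<lambda>z. norm (f z) ^ p)}"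


section \<open>Linear canonical transforms and the correlation operator\<close>

text \<open>
  In a matrix \<open>A\<close> with rows \<open>a b\<close> and \<open>c d\<close>, the entries are
  \<open>a = A$1$1\<close>, \<open>b = A$1$2\<close>, \<open>c = A$2$1\<close>, \<open>d = A$2$2\<close>.
\<close>

definition lct_kernel :: "quat \<Rightarrow> real^2^2 \<Rightarrow> real \<Rightarrow> real \<Rightarrow> quat" where
  "lct_kernel l A x u =
     1 / Hmu_sqrt (of_real (2 * pi * A$1$2) * l) *
     exp (l * of_real (A$1$1 / (2 * A$1$2) * x\<^sup>2 - 1 / A$1$2 * x * u
                       + A$2$2 / (2 * A$1$2) * u\<^sup>2))"

definition corr_weight :: "quat \<Rightarrow> real^2^2 \<Rightarrow> real \<Rightarrow> real \<Rightarrow> quat" where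
  "corr_weight l A t \<tau> =
     1 / Hmu_sqrt (of_real (2 * pi * A$1$2) * l) *
     exp (l * of_real (\<tau> * (\<tau> - t) * (A$1$1 / A$1$2)))"

definition qlct ::
  "quat \<Rightarrow> quat \<Rightarrow> real^2^2 \<Rightarrow> real^2^2 \<Rightarrow> (real \<times> real \<Rightarrow> quat) \<Rightarrow> real \<times> real \<Rightarrow> quat" where
  "qlct l l' A1 A2 f =
     (\<lambda>(u, v). \<integral>(x, y). lct_kernel l A1 x u * f (x, y) * lct_kernel l' A2 y v \<partial>lebesgue)"

definition qcorr ::
  "real^2^2 \<Rightarrow> real^2^2 \<Rightarrow> (real \<times> real \<Rightarrow> quat) \<Rightarrow> (real \<times> real \<Rightarrow> quat) \<Rightarrow> real \<times> real \<Rightarrow> quat"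
  where
  "qcorr A1 A2 f g =
     (\<lambda>(x, y). \<integral>(\<tau>1, \<tau>2). corr_weight qmu A1 x \<tau>1 * qcnj (f (- \<tau>1, - \<tau>2)) *
                          g (x - \<tau>1, y - \<tau>2) * corr_weight qmu A2 y \<tau>2 \<partial>lebesgue)"

definition half_mat :: "real^2^2 \<Rightarrow> real^2^2" where
  "half_mat A = vector [vector [A$1$1, A$1$2],
                        vector [A$2$1 / 2 - 1 / (2 * A$1$2), A$2$2 / 2]]"

lemma half_mat_nth:
  "half_mat A $ 1 $ 1 = A$1$1" "half_mat A $ 1 $ 2 = A$1$2"
  "half_mat A $ 2 $ 1 = A$2$1 / 2 - 1 / (2 * A$1$2)" "half_mat A $ 2 $ 2 = A$2$2 / 2"
  by (simp_all add: half_mat_def)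

lemma det_half_mat:
  assumes "det A = 1" and "A$1$2 \<noteq> 0"
  shows "det (half_mat A) = 1"
  using assms by (simp add: det_2 half_mat_nth field_simps)

end

theory Submission
  imports Defs
begin

text \<open>
  Identify \<open>\<real> + \<mu>\<real>\<close> with the complex numbers. Completing the square in the exponents gives
  \<open>K(x,u) W(x,\<tau>) = exp(-\<mu>du\<^sup>2/2b) K(-\<tau>,-u) K(x-\<tau>,u)\<close>, and
  moving every \<open>\<nu>\<close> to the right conjugates the complex factors that it passes, turning the
  right-hand kernel for \<open>\<mu>\<close> into the one for \<open>-\<mu>\<close>. The integrand of the transform of the
  correlation thus becomes a sum of four convolution integrands \<open>F(-\<tau>) G(z-\<tau>)\<close> with complex
  integrable \<open>F\<close> and \<open>G\<close>, and Fubini evaluates each as \<open>(\<integral>F)(\<integral>G)\<close>. Halving \<open>d\<close> in a matrix removes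
  half of the chirp from each of the two kernels, so that the chirp is absorbed in their product.
\<close>

section \<open>Invariance of Lebesgue measure and convolution integrals\<close>

lemma distr_lborel_minus_left:
  "distr lborel borel (\<lambda>t. z - t) = (lborel :: 'a::euclidean_space measure)"
  \<comment> \<open>The map is affine with scale factor -1, so its Jacobian has absolute value
    1.\<close>
  using lborel_affine[of "-1" z] by (simp add: density_1)

lemma distr_lborel_minus_right:
  "distr lborel borel (\<lambda>t. t - z) = (lborel :: 'a::euclidean_space measure)"
proof -
  have "(\<lambda>t. t - z) = (+) (- z)"
    by (simp add: fun_eq_iff)
  then show ?thesis
    by (simp add: lborel_distr_plus)
qed

lemma AE_lborel_minus_left:
  assumes "AE t in (lborel :: 'a::euclidean_space measure). P t"
  shows "AE t in (lborel :: 'a measure). P (z - t)"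
proof -
  have "AE t in distr lborel borel (\<lambda>t. z - t). P t"
    using assms unfolding distr_lborel_minus_left .
  then show ?thesis
    by (rule AE_distrD[rotated]) simp
qed

lemma integrable_lborel_minus_left:
  fixes F :: "'a::euclidean_space \<Rightarrow> 'b::{banach, second_countable_topology}"
  assumes "integrable lborel F"
  shows "integrable lborel (\<lambda>t. F (z - t))"
  using assms integrable_distr[of "\<lambda>t. z - t" lborel borel F]
  by (simp add: distr_lborel_minus_left)

lemma integral_lborel_minus_left:
  fixes F :: "'a::euclidean_space \<Rightarrow> 'b::{banach, second_countable_topology}"
  assumes [measurable]: "F \<in> borel_measurable borel"
  shows "(\<integral>t. F (z - t) \<partial>lborel) = integral\<^sup>L lborel F"
  using integral_distr[of "\<lambda>t. z - t" lborel borel F] by (simp add: distr_lborel_minus_left)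

lemma integrable_lborel_minus_right:
  fixes F :: "'a::euclidean_space \<Rightarrow> 'b::{banach, second_countable_topology}"
  assumes "integrable lborel F"
  shows "integrable lborel (\<lambda>t. F (t - z))"
  using assms integrable_distr[of "\<lambda>t. t - z" lborel borel F]
  by (simp add: distr_lborel_minus_right)

lemma integral_lborel_minus_right:
  fixes F :: "'a::euclidean_space \<Rightarrow> 'b::{banach, second_countable_topology}"
  assumes [measurable]: "F \<in> borel_measurable borel"
  shows "(\<integral>t. F (t - z) \<partial>lborel) = integral\<^sup>L lborel F"
  using integral_distr[of "\<lambda>t. t - z" lborel borel F] by (simp add: distr_lborel_minus_right)

text \<open>Fubini's theorem. The reflected argument \<open>- t\<close> is the one in which the
  correlation evaluates its first function, and the factors keep their order because multiplication
  need not commute.\<close>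

lemma lborel_convolution:
  fixes F G :: "'a::euclidean_space \<Rightarrow> 'b::{real_normed_div_algebra, banach, second_countable_topology}"
  assumes F: "integrable lborel F" and G: "integrable lborel G"
  shows "AE z in lborel. integrable lborel (\<lambda>t. F (- t) * G (z - t))"
    and "integrable lborel (\<lambda>z. \<integral>t. F (- t) * G (z - t) \<partial>lborel)"
    and "(\<integral>z. (\<integral>t. F (- t) * G (z - t) \<partial>lborel) \<partial>lborel) = integral\<^sup>L lborel F * integral\<^sup>L lborel G"
proof -
  have [measurable]: "F \<in> borel_measurable borel" "G \<in> borel_measurable borel"
    using F G by (auto dest: borel_measurable_integrable)
  have F': "integrable lborel (\<lambda>t. F (- t))"
    using integrable_lborel_minus_left[OF F, of 0] by simp
  \<comment> \<open>Integrating over \<open>z\<close> first is what makes this easy: by translation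
    invariance the inner integral of the norm is \<open>norm (F (- t))\<close> times a
    constant.\<close>
  have I: "integrable (lborel \<Otimes>\<^sub>M lborel) (\<lambda>(t, z). F (- t) * G (z - t))"
  proof (rule lborel_pair.Fubini_integrable)
    have "(\<integral>z. norm (case (t, z) of (t, z) \<Rightarrow> F (- t) * G (z - t)) \<partial>lborel) =
      norm (F (- t)) * (\<integral>z. norm (G z) \<partial>lborel)" for t
      by (simp add: norm_mult integral_lborel_minus_right[of "\<lambda>z. norm (G z)"])
    then show "integrable lborel
        (\<lambda>t. \<integral>z. norm (case (t, z) of (t, z) \<Rightarrow> F (- t) * G (z - t)) \<partial>lborel)"
      using F' by simp
    show "AE t in lborel. integrable lborel (\<lambda>z. case (t, z) of (t, z) \<Rightarrow> F (- t) * G (z - t))"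
      using integrable_lborel_minus_right[OF G] by simp
  qed measurable
  show "AE z in lborel. integrable lborel (\<lambda>t. F (- t) * G (z - t))"
    using lborel_pair.AE_integrable_snd[OF I] .
  show "integrable lborel (\<lambda>z. \<integral>t. F (- t) * G (z - t) \<partial>lborel)"
    using lborel_pair.integrable_snd[OF I] .
  have "(\<integral>z. (\<integral>t. F (- t) * G (z - t) \<partial>lborel) \<partial>lborel) =
      (\<integral>t. (\<integral>z. F (- t) * G (z - t) \<partial>lborel) \<partial>lborel)"
    using lborel_pair.Fubini_integral[OF I] .
  also have "\<dots> = (\<integral>t. F (- t) * integral\<^sup>L lborel G \<partial>lborel)"
    using integrable_lborel_minus_right[OF G] by (simp add: integral_lborel_minus_right)
  also have "\<dots> = integral\<^sup>L lborel F * integral\<^sup>L lborel G"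
    using F' integral_lborel_minus_left[of F 0] by simp
  finally show "(\<integral>z. (\<integral>t. F (- t) * G (z - t) \<partial>lborel) \<partial>lborel) =
      integral\<^sup>L lborel F * integral\<^sup>L lborel G" .
qed

text \<open>The spaces \<open>Lspace p\<close> consist of Lebesgue measurable functions, whereas
  Fubini is applied on a product of two copies of \<open>lborel\<close>, where Borel factors give a
  measurable integrand at once. The available real-valued result is applied to each coordinate, and
  the coordinates are reassembled.\<close>

lemma integrable_lebesgue_borel_representative:
  fixes F :: "'a::euclidean_space \<Rightarrow> 'b::euclidean_space"
  assumes F: "integrable lebesgue F"
  obtains F' where "integrable lborel F'" "AE t in lborel. F t = F' t"
proof -
  have "\<exists>h. h \<in> borel_measurable lborel \<and> (AE t in lborel. F t \<bullet> b = h t)" for b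
    using completion_ex_borel_measurable_real[of "\<lambda>t. F t \<bullet> b" lborel]
      borel_measurable_integrable[OF F] by auto
  then obtain h where h [measurable]: "\<And>b. h b \<in> borel_measurable lborel"
    and ae: "\<And>b. AE t in lborel. F t \<bullet> b = h b t"
    by metis
  let ?F = "\<lambda>t. \<Sum>b\<in>Basis. h b t *\<^sub>R b"
  have "AE t in lborel. \<forall>b\<in>Basis. F t \<bullet> b = h b t"
    using ae by (intro AE_finite_allI) auto
  then have *: "AE t in lborel. F t = ?F t"
    by eventually_elim (metis (mono_tags, lifting) euclidean_representation sum.cong)
  have meas: "?F \<in> borel_measurable lborel"
    by measurable
  then have "integrable lebesgue ?F"
    using F * by (subst integrable_cong_AE[where g = F])
      (auto intro: AE_completion measurable_completion elim!: eventually_mono)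
  then have "integrable lborel ?F"
    using meas by (simp add: integrable_completion)
  then show thesis
    using * by (rule that)
qed

text \<open>Borel representatives reduce this to \<open>lborel_convolution\<close>. Reflections and
  translations preserve null sets, so for every \<open>z\<close> the two integrands agree for almost
  every \<open>t\<close>; hence the inner integrals agree at every \<open>z\<close>.\<close>

lemma lebesgue_convolution:
  fixes F G :: "'a::euclidean_space \<Rightarrow> 'b::{real_normed_div_algebra, euclidean_space}"
  assumes F: "integrable lebesgue F" and G: "integrable lebesgue G"
  shows "AE z in lebesgue. integrable lebesgue (\<lambda>t. F (- t) * G (z - t))"
    and "integrable lebesgue (\<lambda>z. \<integral>t. F (- t) * G (z - t) \<partial>lebesgue)"
    and "(\<integral>z. (\<integral>t. F (- t) * G (z - t) \<partial>lebesgue) \<partial>lebesgue) =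
      integral\<^sup>L lebesgue F * integral\<^sup>L lebesgue G"
proof -
  obtain F' where F': "integrable lborel F'" and aeF: "AE t in lborel. F t = F' t"
    using integrable_lebesgue_borel_representative[OF F] .
  obtain G' where G': "integrable lborel G'" and aeG: "AE t in lborel. G t = G' t"
    using integrable_lebesgue_borel_representative[OF G] .
  have [measurable]: "F' \<in> borel_measurable borel" "G' \<in> borel_measurable borel"
    using F' G' by (auto dest: borel_measurable_integrable)
  have ae: "AE t in lebesgue. F' (- t) * G' (z - t) = F (- t) * G (z - t)" for z
    using AE_lborel_minus_left[OF aeF, of 0] AE_lborel_minus_left[OF aeG, of z]
    by (intro AE_completion) (auto elim!: eventually_elim2)
  have meas': "(\<lambda>t. F' (- t) * G' (z - t)) \<in> borel_measurable lebesgue" for z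
    by (intro measurable_completion) measurable
  have meas: "(\<lambda>t. F (- t) * G (z - t)) \<in> borel_measurable lebesgue" for z
    using borel_measurable_AE[OF meas' ae] .
  have int: "integrable lebesgue (\<lambda>t. F (- t) * G (z - t)) \<longleftrightarrow>
      integrable lborel (\<lambda>t. F' (- t) * G' (z - t))" for z
    using integrable_cong_AE[OF meas' meas ae] by (simp add: integrable_completion)
  have inner: "(\<integral>t. F (- t) * G (z - t) \<partial>lebesgue) = (\<integral>t. F' (- t) * G' (z - t) \<partial>lborel)" for z
    using integral_cong_AE[OF meas' meas ae] by (simp add: integral_completion)
  have eqF: "integral\<^sup>L lebesgue F = integral\<^sup>L lborel F'"
    using integral_cong_AE[of F lebesgue F'] AE_completion[OF aeF] borel_measurable_integrable[OF F]
    by (simp add: integral_completion measurable_completion)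
  have eqG: "integral\<^sup>L lebesgue G = integral\<^sup>L lborel G'"
    using integral_cong_AE[of G lebesgue G'] AE_completion[OF aeG] borel_measurable_integrable[OF G]
    by (simp add: integral_completion measurable_completion)
  have meas2: "(\<lambda>z. \<integral>t. F' (- t) * G' (z - t) \<partial>lborel) \<in> borel_measurable lborel"
    using lborel_convolution(2)[OF F' G'] by (rule borel_measurable_integrable)
  show "AE z in lebesgue. integrable lebesgue (\<lambda>t. F (- t) * G (z - t))"
    unfolding int using lborel_convolution(1)[OF F' G'] by (rule AE_completion)
  show "integrable lebesgue (\<lambda>z. \<integral>t. F (- t) * G (z - t) \<partial>lebesgue)"
    unfolding inner using lborel_convolution(2)[OF F' G'] meas2 by (simp add: integrable_completion)
  show "(\<integral>z. (\<integral>t. F (- t) * G (z - t) \<partial>lebesgue) \<partial>lebesgue) =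
      integral\<^sup>L lebesgue F * integral\<^sup>L lebesgue G"
    unfolding inner eqF eqG
    using lborel_convolution(3)[OF F' G'] meas2 by (simp add: integral_completion)
qed

section \<open>The complex numbers embedded as \<open>Hmu\<close>\<close>

lemma Hmu_of_complex_sel [simp]:
  "re_part (Hmu_of_complex z) = Re z" "mu_part (Hmu_of_complex z) = Im z"
  "nu_part (Hmu_of_complex z) = 0" "eta_part (Hmu_of_complex z) = 0"
  by (simp_all add: Hmu_of_complex_def of_real_quat qmu_def)

lemma Hmu_eq_range: "Hmu = range Hmu_of_complex"
proof (intro equalityI subsetI)
  fix q assume "q \<in> Hmu"
  then obtain r s where "q = of_real r + qmu * of_real s"
    by (auto simp: Hmu_def)
  then have "q = Hmu_of_complex (Complex r s)"
    by (simp add: Hmu_of_complex_def)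
  then show "q \<in> range Hmu_of_complex"
    by blast
qed (auto simp: Hmu_def Hmu_of_complex_def)

lemma Hmu_of_complex_add: "Hmu_of_complex (z + w) = Hmu_of_complex z + Hmu_of_complex w"
  and Hmu_of_complex_diff: "Hmu_of_complex (z - w) = Hmu_of_complex z - Hmu_of_complex w"
  and Hmu_of_complex_minus: "Hmu_of_complex (- z) = - Hmu_of_complex z"
  and Hmu_of_complex_mult: "Hmu_of_complex (z * w) = Hmu_of_complex z * Hmu_of_complex w"
  and Hmu_of_complex_1: "Hmu_of_complex 1 = 1"
  and Hmu_of_complex_0: "Hmu_of_complex 0 = 0"
  and Hmu_of_complex_of_real: "Hmu_of_complex (of_real r) = of_real r"
  and Hmu_of_complex_ii: "Hmu_of_complex \<i> = qmu"
  and Hmu_of_complex_scaleR: "Hmu_of_complex (r *\<^sub>R z) = r *\<^sub>R Hmu_of_complex z"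
  and Hmu_of_complex_cnj: "Hmu_of_complex (cnj z) = qcnj (Hmu_of_complex z)"
  and qnu_Hmu_of_complex: "qnu * Hmu_of_complex z = Hmu_of_complex (cnj z) * qnu"
  by (simp_all add: quat_eq_iff of_real_quat qmu_def qnu_def)

lemma Hmu_of_complex_inverse: "Hmu_of_complex (inverse z) = inverse (Hmu_of_complex z)"
proof (cases "z = 0")
  case False
  then have "Hmu_of_complex z * Hmu_of_complex (inverse z) = 1"
    by (simp flip: Hmu_of_complex_mult Hmu_of_complex_1)
  then show ?thesis
    by (simp add: inverse_unique)
qed (simp add: Hmu_of_complex_0)

lemma Hmu_of_complex_divide: "Hmu_of_complex (z / w) = Hmu_of_complex z / Hmu_of_complex w"
  by (simp add: divide_inverse Hmu_of_complex_mult Hmu_of_complex_inverse)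

lemma bounded_linear_Hmu_of_complex: "bounded_linear Hmu_of_complex"
  by (intro linear_conv_bounded_linear[THEN iffD1] linearI Hmu_of_complex_add Hmu_of_complex_scaleR)

lemma Hmu_of_complex_power: "Hmu_of_complex (z ^ n) = Hmu_of_complex z ^ n"
  by (induction n) (simp_all add: Hmu_of_complex_1 Hmu_of_complex_mult)

text \<open>A bounded linear ring homomorphism can be applied to the exponential series term by
  term.\<close>

lemma Hmu_of_complex_exp: "Hmu_of_complex (exp z) = exp (Hmu_of_complex z)"
  unfolding exp_def
  by (subst bounded_linear.suminf[OF bounded_linear_Hmu_of_complex summable_exp_generic])
     (simp add: Hmu_of_complex_scaleR Hmu_of_complex_power)

lemma Hmu_of_complex_eq_0_iff: "Hmu_of_complex z = 0 \<longleftrightarrow> z = 0"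
  by (simp add: quat_eq_iff complex_eq_iff)

text \<open>Integrability of \<open>h\<close> is not assumed: multiplication by nonzero
  \<open>k\<close> and \<open>k'\<close> is invertible, so if \<open>h\<close> fails to be
  integrable then so does the product, and both integrals have the default value 0.\<close>

lemma integral_mult_both_sides:
  fixes h :: "'a \<Rightarrow> 'b::{real_normed_div_algebra, banach, second_countable_topology}"
  assumes "k \<noteq> 0" and "k' \<noteq> 0"
  shows "(\<integral>t. k * h t * k' \<partial>M) = k * integral\<^sup>L M h * k'"
proof -
  have "bounded_linear (\<lambda>q. c * q * c')" for c c' :: 'b
    using bounded_linear_compose[OF bounded_linear_mult_left[of c'] bounded_linear_mult_right[of c]]
    by simp
  then show ?thesis
    using assms
    by (intro integral_bounded_linear'[where T = "\<lambda>q. k * q * k'" and T' = "\<lambda>q. inverse k * q * inverse k'"])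
       (simp_all add: mult.assoc flip: mult.assoc[of "inverse k" k])
qed

section \<open>The kernels as complex functions\<close>

definition cchirp :: "real^2^2 \<Rightarrow> real \<Rightarrow> complex" where
  "cchirp A u = exp (- \<i> * of_real (A$2$2 / (2 * A$1$2) * u\<^sup>2))"

definition clct :: "real^2^2 \<Rightarrow> real \<Rightarrow> real \<Rightarrow> complex" where
  "clct A x u = 1 / csqrt (Complex 0 (2 * pi * A$1$2)) *
     exp (\<i> * of_real (A$1$1 / (2 * A$1$2) * x\<^sup>2 - 1 / A$1$2 * x * u + A$2$2 / (2 * A$1$2) * u\<^sup>2))"

definition cweight :: "real^2^2 \<Rightarrow> real \<Rightarrow> real \<Rightarrow> complex" where
  "cweight A t \<tau> = 1 / csqrt (Complex 0 (2 * pi * A$1$2)) *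
     exp (\<i> * of_real (\<tau> * (\<tau> - t) * (A$1$1 / A$1$2)))"

lemma Hmu_sqrt_qmu: "Hmu_sqrt (of_real r * qmu) = Hmu_of_complex (csqrt (Complex 0 r))"
  by (simp add: Hmu_sqrt_def of_real_quat qmu_def)

text \<open>The principal root commutes with conjugation off the branch cut, and a nonzero imaginary
  number does not lie on the cut.\<close>

lemma Hmu_sqrt_minus_qmu:
  assumes "r \<noteq> 0"
  shows "Hmu_sqrt (of_real r * - qmu) = Hmu_of_complex (cnj (csqrt (Complex 0 r)))"
proof -
  have "Complex 0 r \<notin> \<real>\<^sub>\<le>\<^sub>0"
    using assms by (auto simp: complex_nonpos_Reals_iff)
  then have "cnj (csqrt (Complex 0 r)) = csqrt (Complex 0 (- r))"
    by (simp add: cnj_csqrt complex_cnj)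
  then show ?thesis
    by (simp add: Hmu_sqrt_def of_real_quat qmu_def)
qed

lemma exp_qmu: "exp (qmu * of_real r) = Hmu_of_complex (exp (\<i> * of_real r))"
  by (simp add: Hmu_of_complex_exp Hmu_of_complex_mult Hmu_of_complex_ii Hmu_of_complex_of_real)

lemma exp_minus_qmu: "exp (- qmu * of_real r) = Hmu_of_complex (exp (- \<i> * of_real r))"
  by (simp add: Hmu_of_complex_exp Hmu_of_complex_mult Hmu_of_complex_minus Hmu_of_complex_ii
      Hmu_of_complex_of_real)

lemma lct_kernel_qmu: "lct_kernel qmu A x u = Hmu_of_complex (clct A x u)"
  unfolding lct_kernel_def clct_def
  by (simp only: Hmu_sqrt_qmu exp_qmu Hmu_of_complex_mult Hmu_of_complex_divide Hmu_of_complex_1)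

lemma lct_kernel_minus_qmu:
  assumes "A$1$2 \<noteq> 0"
  shows "lct_kernel (- qmu) A x u = Hmu_of_complex (cnj (clct A x u))"
proof -
  have "cnj (clct A x u) = 1 / cnj (csqrt (Complex 0 (2 * pi * A$1$2))) *
     exp (- \<i> * of_real (A$1$1 / (2 * A$1$2) * x\<^sup>2 - 1 / A$1$2 * x * u + A$2$2 / (2 * A$1$2) * u\<^sup>2))"
    by (simp add: clct_def exp_cnj)
  moreover have "Hmu_sqrt (of_real (2 * pi * A$1$2) * - qmu) =
      Hmu_of_complex (cnj (csqrt (Complex 0 (2 * pi * A$1$2))))"
    using assms by (intro Hmu_sqrt_minus_qmu) simp
  ultimately show ?thesis
    unfolding lct_kernel_def
    by (simp only: exp_minus_qmu Hmu_of_complex_mult Hmu_of_complex_divide Hmu_of_complex_1)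
qed

lemma corr_weight_qmu: "corr_weight qmu A t \<tau> = Hmu_of_complex (cweight A t \<tau>)"
  unfolding corr_weight_def cweight_def
  by (simp only: Hmu_sqrt_qmu exp_qmu Hmu_of_complex_mult Hmu_of_complex_divide Hmu_of_complex_1)

text \<open>The part quadratic in \<open>x\<close> and \<open>\<tau>\<close> rests on x^2/2 +
  \<tau>(\<tau> - x) = \<tau>^2/2 + (x - \<tau>)^2/2. The two kernels on the right contribute the
  quadratic term in \<open>u\<close> twice, and \<open>cchirp\<close> removes one copy; each side
  carries the root prefactor twice.\<close>

lemma clct_cweight:
  assumes "A$1$2 \<noteq> 0"
  shows "clct A x u * cweight A x \<tau> = cchirp A u * clct A (- \<tau>) (- u) * clct A (x - \<tau>) u"
proof -
  let ?a = "A$1$1" and ?b = "A$1$2" and ?d = "A$2$2"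
  have "?a / (2 * ?b) * x\<^sup>2 - 1 / ?b * x * u + ?d / (2 * ?b) * u\<^sup>2 + \<tau> * (\<tau> - x) * (?a / ?b) =
      - (?d / (2 * ?b) * u\<^sup>2) + (?a / (2 * ?b) * (- \<tau>)\<^sup>2 - 1 / ?b * (- \<tau>) * (- u) + ?d / (2 * ?b) * (- u)\<^sup>2)
      + (?a / (2 * ?b) * (x - \<tau>)\<^sup>2 - 1 / ?b * (x - \<tau>) * u + ?d / (2 * ?b) * u\<^sup>2)" (is "?r + ?s = ?p + ?q + ?t")
    using assms by (simp add: field_simps power2_eq_square)
  then have "exp (\<i> * of_real ?r) * exp (\<i> * of_real ?s) =
      exp (\<i> * of_real ?p) * exp (\<i> * of_real ?q) * exp (\<i> * of_real ?t)"
    by (simp only: mult_exp_exp flip: distrib_left of_real_add)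
  moreover have "cchirp A u = exp (\<i> * of_real ?p)"
    by (simp add: cchirp_def)
  ultimately show ?thesis
    by (simp only: clct_def cweight_def mult_ac)
qed

text \<open>Halving d changes the coefficient of u^2 in the exponent by -d/(4b), and
  \<open>e\<close> is the resulting phase. It depends on \<open>u\<close> only through its square,
  so one \<open>e\<close> serves both \<open>u\<close> and \<open>- u\<close>.\<close>

lemma clct_half_mat:
  assumes "A$1$2 \<noteq> 0"
  obtains e where "\<And>x. clct (half_mat A) x u = e * clct A x u"
    and "\<And>x. clct (half_mat A) x (- u) = e * clct A x (- u)" and "e * e = cchirp A u"
proof
  let ?d = "- (A$2$2 / (4 * A$1$2) * u\<^sup>2)"
  let ?e = "exp (\<i> * of_real ?d)"
  have *: "clct (half_mat A) x w = ?e * clct A x w" if "w\<^sup>2 = u\<^sup>2" for x w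
  proof -
    have "A$1$1 / (2 * A$1$2) * x\<^sup>2 - 1 / A$1$2 * x * w + A$2$2 / 2 / (2 * A$1$2) * w\<^sup>2 =
      ?d + (A$1$1 / (2 * A$1$2) * x\<^sup>2 - 1 / A$1$2 * x * w + A$2$2 / (2 * A$1$2) * w\<^sup>2)"
      (is "?r = _ + ?s")
      using assms that by (simp add: field_simps)
    then have "exp (\<i> * of_real ?r) = ?e * exp (\<i> * of_real ?s)"
      by (simp only: mult_exp_exp flip: distrib_left of_real_add)
    then show ?thesis
      by (simp only: clct_def half_mat_nth mult_ac)
  qed
  show "clct (half_mat A) x u = ?e * clct A x u" for x
    by (rule *) simp
  show "clct (half_mat A) x (- u) = ?e * clct A x (- u)" for x
    by (rule *) simp
  show "?e * ?e = cchirp A u"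
    by (simp add: cchirp_def mult_exp_exp mult_ac)
qed

section \<open>Transforms of integrable complex functions\<close>

lemma norm_clct: "cmod (clct A x u) = 1 / cmod (csqrt (Complex 0 (2 * pi * A$1$2)))"
  by (simp add: clct_def norm_mult norm_divide)

lemma clct_nonzero: "A$1$2 \<noteq> 0 \<Longrightarrow> clct A x u \<noteq> 0"
  by (simp add: clct_def complex_eq_iff[of "Complex _ _"])

lemma continuous_on_clct [continuous_intros]:
  "continuous_on S h \<Longrightarrow> continuous_on S (\<lambda>x. clct A (h x) u)"
  unfolding clct_def by (intro continuous_intros)

text \<open>
  The parameter \<open>s\<close> is \<^term>\<open>id\<close> or \<^term>\<open>cnj\<close>, according to whether the right-hand kernel
  belongs to \<^term>\<open>qmu\<close> or to \<^term>\<open>- qmu\<close>.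
\<close>

definition clct_integrand :: "(complex \<Rightarrow> complex) \<Rightarrow> real^2^2 \<Rightarrow> real^2^2 \<Rightarrow> real \<Rightarrow> real \<Rightarrow>
    (real \<times> real \<Rightarrow> complex) \<Rightarrow> real \<times> real \<Rightarrow> complex" where
  "clct_integrand s A1 A2 u v h z = clct A1 (fst z) u * h z * s (clct A2 (snd z) v)"

abbreviation clct_integral :: "(complex \<Rightarrow> complex) \<Rightarrow> real^2^2 \<Rightarrow> real^2^2 \<Rightarrow> real \<Rightarrow> real \<Rightarrow>
    (real \<times> real \<Rightarrow> complex) \<Rightarrow> complex" where
  "clct_integral s A1 A2 u v h \<equiv> integral\<^sup>L lebesgue (clct_integrand s A1 A2 u v h)"

text \<open>Both kernels are continuous and have constant modulus, so a constant multiple of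
  \<open>h\<close> dominates the integrand.\<close>

lemma integrable_clct_integrand:
  assumes h: "integrable lebesgue h" and s: "s \<in> {id, cnj}"
  shows "integrable lebesgue (clct_integrand s A1 A2 u v h)"
proof (rule Bochner_Integration.integrable_bound)
  have "continuous_on UNIV (\<lambda>z::real \<times> real. clct A1 (fst z) u)"
    "continuous_on UNIV (\<lambda>z::real \<times> real. s (clct A2 (snd z) v))"
    using s by (auto intro!: continuous_intros)
  then have "(\<lambda>z::real \<times> real. clct A1 (fst z) u) \<in> borel_measurable lebesgue"
    "(\<lambda>z::real \<times> real. s (clct A2 (snd z) v)) \<in> borel_measurable lebesgue"
    by (auto intro!: measurable_completion borel_measurable_continuous_onI)
  then show "clct_integrand s A1 A2 u v h \<in> borel_measurable lebesgue"
    using borel_measurable_integrable[OF h] unfolding clct_integrand_def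
    by (intro borel_measurable_times)
  let ?c = "1 / cmod (csqrt (Complex 0 (2 * pi * A1$1$2))) *
    (1 / cmod (csqrt (Complex 0 (2 * pi * A2$1$2))))"
  show "integrable lebesgue (\<lambda>z. ?c *\<^sub>R h z)"
    using h by (intro integrable_scaleR_right)
  have "cmod (s w) = cmod w" for w
    using s by auto
  then show "AE z in lebesgue. norm (clct_integrand s A1 A2 u v h z) \<le> norm (?c *\<^sub>R h z)"
    by (intro AE_I2) (simp add: clct_integrand_def norm_mult norm_clct)
qed

text \<open>All three factors of the integrand lie in \<open>Hmu\<close>, so the bounded linear
  embedding can be pulled out of the integral.\<close>

lemma qlct_qmu_qmu:
  assumes "integrable lebesgue h"
  shows "qlct qmu qmu A1 A2 (\<lambda>z. Hmu_of_complex (h z)) (u, v) =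
    Hmu_of_complex (clct_integral id A1 A2 u v h)"
  using integral_bounded_linear[OF bounded_linear_Hmu_of_complex
      integrable_clct_integrand[OF assms, of id A1 A2 u v]]
  by (simp add: qlct_def clct_integrand_def lct_kernel_qmu Hmu_of_complex_mult case_prod_beta')

lemma qlct_qmu_minus_qmu:
  assumes "integrable lebesgue h" and "A2$1$2 \<noteq> 0"
  shows "qlct qmu (- qmu) A1 A2 (\<lambda>z. Hmu_of_complex (h z)) (u, v) =
    Hmu_of_complex (clct_integral cnj A1 A2 u v h)"
  using integral_bounded_linear[OF bounded_linear_Hmu_of_complex
      integrable_clct_integrand[OF assms(1), of cnj A1 A2 u v]] assms(2)
  by (simp add: qlct_def clct_integrand_def lct_kernel_qmu lct_kernel_minus_qmu Hmu_of_complex_mult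
      case_prod_beta')

text \<open>The second hypothesis speaks of the kernel after \<open>s\<close> is applied, so that
  for \<open>s = cnj\<close> the factor \<open>e2\<close> can be instantiated by a conjugated
  phase.\<close>

lemma clct_integral_scale:
  assumes "\<And>x. clct B1 x u = e1 * clct A1 x u" and "\<And>y. s (clct B2 y v) = e2 * s (clct A2 y v)"
  shows "clct_integral s B1 B2 u v h = e1 * e2 * clct_integral s A1 A2 u v h"
proof -
  have "clct_integrand s B1 B2 u v h = (\<lambda>z. e1 * e2 * clct_integrand s A1 A2 u v h z)"
    by (simp add: fun_eq_iff clct_integrand_def assms mult_ac)
  then show ?thesis
    by simp
qed

section \<open>Symplectic components of products and integrals\<close>

text \<open>The left factor is the conjugate of \<open>a + b * qnu\<close>, which is
  \<open>cnj a - b * qnu\<close>. Expanding against \<open>c + d * qnu\<close>, passing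
  \<open>qnu\<close> over \<open>c\<close> and \<open>d\<close>, and using that \<open>qnu\<close>
  squares to -1 gives the four products of the theorem.\<close>

lemma qcnj_mult_symplectic:
  "qcnj (Hmu_of_complex a + qnu * qcnj (Hmu_of_complex b)) *
      (Hmu_of_complex c + qnu * qcnj (Hmu_of_complex d)) =
    Hmu_of_complex (cnj a * c + b * cnj d) + Hmu_of_complex (cnj a * d - b * cnj c) * qnu"
  by (simp add: quat_eq_iff qnu_def algebra_simps)

text \<open>Here \<open>k\<close>, \<open>k'\<close> stand for the transform kernels and
  \<open>w\<close>, \<open>w'\<close> for the correlation weights. The groupings
  \<open>k * w\<close> and \<open>k' * w'\<close> are those that \<open>clct_cweight\<close>
  rewrites; the conjugation in the second component comes from moving \<open>qnu\<close> past the
  right-hand factors.\<close>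

lemma Hmu_sandwich:
  "Hmu_of_complex k * (Hmu_of_complex w * (Hmu_of_complex p + Hmu_of_complex q * qnu) *
      Hmu_of_complex w') * Hmu_of_complex k' =
    Hmu_of_complex (k * w * p * (k' * w')) + Hmu_of_complex (k * w * q * cnj (k' * w')) * qnu"
proof -
  have *: "x * qnu * Hmu_of_complex z = x * Hmu_of_complex (cnj z) * qnu" for x z
    by (simp add: mult.assoc qnu_Hmu_of_complex)
  show ?thesis
    by (simp add: distrib_left distrib_right * mult.assoc [symmetric] flip: Hmu_of_complex_mult)
       (simp add: mult_ac)
qed

lemma
  assumes p: "integrable M p" and q: "integrable M q"
  shows integrable_symplectic: "integrable M (\<lambda>t. Hmu_of_complex (p t) + Hmu_of_complex (q t) * qnu)"
    and integral_symplectic: "(\<integral>t. Hmu_of_complex (p t) + Hmu_of_complex (q t) * qnu \<partial>M) =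
      Hmu_of_complex (integral\<^sup>L M p) + Hmu_of_complex (integral\<^sup>L M q) * qnu"
proof -
  note int = integrable_bounded_linear[OF bounded_linear_Hmu_of_complex]
  note eq = integral_bounded_linear[OF bounded_linear_Hmu_of_complex]
  show "integrable M (\<lambda>t. Hmu_of_complex (p t) + Hmu_of_complex (q t) * qnu)"
    using int[OF p] int[OF q] by simp
  show "(\<integral>t. Hmu_of_complex (p t) + Hmu_of_complex (q t) * qnu \<partial>M) =
      Hmu_of_complex (integral\<^sup>L M p) + Hmu_of_complex (integral\<^sup>L M q) * qnu"
    using int[OF p] int[OF q] eq[OF p] eq[OF q] by simp
qed

section \<open>The transform of the correlation\<close>

lemma qlct_qcorr:
  fixes \<alpha> \<beta> \<gamma> \<delta> :: "real \<times> real \<Rightarrow> complex"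
  assumes A: "A1$1$2 \<noteq> 0" "A2$1$2 \<noteq> 0"
    and int: "integrable lebesgue \<alpha>" "integrable lebesgue \<beta>"
      "integrable lebesgue \<gamma>" "integrable lebesgue \<delta>"
  shows "qlct qmu qmu A1 A2
      (qcorr A1 A2 (\<lambda>z. Hmu_of_complex (\<alpha> z) + qnu * qcnj (Hmu_of_complex (\<beta> z)))
        (\<lambda>z. Hmu_of_complex (\<gamma> z) + qnu * qcnj (Hmu_of_complex (\<delta> z)))) (u, v) =
    Hmu_of_complex (cchirp A1 u * cchirp A2 v *
      (clct_integral id A1 A2 (- u) (- v) (\<lambda>z. cnj (\<alpha> z)) * clct_integral id A1 A2 u v \<gamma> +
       clct_integral id A1 A2 (- u) (- v) \<beta> * clct_integral id A1 A2 u v (\<lambda>z. cnj (\<delta> z)))) -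
    Hmu_of_complex (cchirp A1 u * cnj (cchirp A2 v) *
      (clct_integral cnj A1 A2 (- u) (- v) \<beta> * clct_integral cnj A1 A2 u v (\<lambda>z. cnj (\<gamma> z)) -
       clct_integral cnj A1 A2 (- u) (- v) (\<lambda>z. cnj (\<alpha> z)) * clct_integral cnj A1 A2 u v \<delta>)) * qnu"
    (is "?lhs = ?rhs")
proof -
  let ?I = "\<lambda>s. clct_integrand s A1 A2 (- u) (- v)" and ?J = "\<lambda>s. clct_integrand s A1 A2 u v"
  let ?f = "\<lambda>z. Hmu_of_complex (\<alpha> z) + qnu * qcnj (Hmu_of_complex (\<beta> z))"
  let ?g = "\<lambda>z. Hmu_of_complex (\<gamma> z) + qnu * qcnj (Hmu_of_complex (\<delta> z))"
  let ?S = "\<lambda>p q. Hmu_of_complex p + Hmu_of_complex q * qnu"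
  \<comment> \<open>These are the chirps left over by \<open>clct_cweight\<close>. In the
    coefficient of \<open>qnu\<close> the identity for \<open>A2\<close> is used in conjugated form,
    hence the conjugate in \<open>e'\<close>.\<close>
  define e e' where "e = cchirp A1 u * cchirp A2 v" and "e' = cchirp A1 u * cnj (cchirp A2 v)"
  define conv where "conv = (\<lambda>F G z. \<integral>t. F (- t) * G (z - t) \<partial>(lebesgue :: (real \<times> real) measure) :: complex)"
  have int': "integrable lebesgue (\<lambda>z. cnj (\<alpha> z))" "integrable lebesgue (\<lambda>z. cnj (\<gamma> z))"
    "integrable lebesgue (\<lambda>z. cnj (\<delta> z))"
    using int by simp_all
  have s: "id \<in> {id, cnj}" "cnj \<in> {id, cnj}"
    by simp_all
  have conv_int: "integrable lebesgue (conv (?I s h) (?J s k))"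
    and conv_eq: "integral\<^sup>L lebesgue (conv (?I s h) (?J s k)) =
      integral\<^sup>L lebesgue (?I s h) * integral\<^sup>L lebesgue (?J s k)"
    and conv_AE: "AE z in lebesgue. integrable lebesgue (\<lambda>t. ?I s h (- t) * ?J s k (z - t))"
    if "integrable lebesgue h" "integrable lebesgue k" "s \<in> {id, cnj}" for s h k
    unfolding conv_def
    by (rule lebesgue_convolution[OF integrable_clct_integrand[OF that(1,3)]
        integrable_clct_integrand[OF that(2,3)]])+
  \<comment> \<open>\<open>P\<close> and \<open>Q\<close> are the symplectic components of the full
    double integrand, already written as convolution integrands.\<close>
  define P where "P = (\<lambda>z t. e * (?I id (\<lambda>z. cnj (\<alpha> z)) (- t) * ?J id \<gamma> (z - t) +
      ?I id \<beta> (- t) * ?J id (\<lambda>z. cnj (\<delta> z)) (z - t)))"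
  define Q where "Q = (\<lambda>z t. e' * (?I cnj (\<lambda>z. cnj (\<alpha> z)) (- t) * ?J cnj \<delta> (z - t) -
      ?I cnj \<beta> (- t) * ?J cnj (\<lambda>z. cnj (\<gamma> z)) (z - t)))"
  have pointwise: "lct_kernel qmu A1 (fst z) u * (corr_weight qmu A1 (fst z) (fst t) *
      qcnj (?f (- t)) * ?g (z - t) * corr_weight qmu A2 (snd z) (snd t)) *
      lct_kernel qmu A2 (snd z) v = ?S (P z t) (Q z t)" for z t
  proof -
    have "clct A1 (fst z) u * cweight A1 (fst z) (fst t) =
        cchirp A1 u * clct A1 (fst (- t)) (- u) * clct A1 (fst (z - t)) u"
      "clct A2 (snd z) v * cweight A2 (snd z) (snd t) =
        cchirp A2 v * clct A2 (snd (- t)) (- v) * clct A2 (snd (z - t)) v"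
      using clct_cweight[OF A(1)] clct_cweight[OF A(2)] by simp_all
    then show ?thesis
      \<comment> \<open>This instance of associativity brackets the conjugate of \<open>?f\<close>
        with \<open>?g\<close>, so that \<open>qcnj_mult_symplectic\<close> can rewrite their
        product.\<close>
      unfolding lct_kernel_qmu corr_weight_qmu mult.assoc[of _ "qcnj _"] qcnj_mult_symplectic
        Hmu_sandwich P_def Q_def e_def e'_def clct_integrand_def
      by (simp add: algebra_simps)
  qed
  let ?cP = "\<lambda>z. e * (conv (?I id (\<lambda>z. cnj (\<alpha> z))) (?J id \<gamma>) z +
      conv (?I id \<beta>) (?J id (\<lambda>z. cnj (\<delta> z))) z)"
  let ?cQ = "\<lambda>z. e' * (conv (?I cnj (\<lambda>z. cnj (\<alpha> z))) (?J cnj \<delta>) z -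
      conv (?I cnj \<beta>) (?J cnj (\<lambda>z. cnj (\<gamma> z))) z)"
  define T where "T = (\<lambda>z. lct_kernel qmu A1 (fst z) u * qcorr A1 A2 ?f ?g z * lct_kernel qmu A2 (snd z) v)"
  \<comment> \<open>Valid at every \<open>z\<close>, even where the correlation integrand is not
    integrable, because the outer kernels never vanish.\<close>
  have T_eq: "T z = (\<integral>t. ?S (P z t) (Q z t) \<partial>lebesgue)" for z
  proof -
    have ne: "lct_kernel qmu A1 (fst z) u \<noteq> 0" "lct_kernel qmu A2 (snd z) v \<noteq> 0"
      using A by (simp_all add: lct_kernel_qmu clct_nonzero Hmu_of_complex_eq_0_iff)
    have "qcorr A1 A2 ?f ?g z = (\<integral>t. corr_weight qmu A1 (fst z) (fst t) *
      qcnj (?f (- t)) * ?g (z - t) * corr_weight qmu A2 (snd z) (snd t) \<partial>lebesgue)"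
      by (cases z) (simp add: qcorr_def case_prod_beta' uminus_prod_def minus_prod_def)
    then show ?thesis
      unfolding T_def pointwise[symmetric] integral_mult_both_sides[OF ne] by (simp only:)
  qed
  \<comment> \<open>Splitting the inner integral into four convolutions needs each of them to be
    integrable, which is known only for almost every \<open>z\<close>.\<close>
  have T_AE: "AE z in lebesgue. ?S (?cP z) (?cQ z) = T z"
    using conv_AE[OF int'(1) int(3) s(1)] conv_AE[OF int(2) int'(3) s(1)]
      conv_AE[OF int'(1) int(4) s(2)] conv_AE[OF int(2) int'(2) s(2)]
  proof (eventually_elim, goal_cases)
    case (1 z)
    have "integrable lebesgue (P z)" "integrable lebesgue (Q z)"
      unfolding P_def Q_def using 1
      by (auto intro!: integrable_mult_right Bochner_Integration.integrable_add Bochner_Integration.integrable_diff)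
    note PQ = this
    have "integral\<^sup>L lebesgue (P z) = ?cP z" "integral\<^sup>L lebesgue (Q z) = ?cQ z"
      unfolding P_def Q_def conv_def using 1
      by (simp_all add: Bochner_Integration.integral_add Bochner_Integration.integral_diff)
    then show ?case
      by (simp only: T_eq integral_symplectic[OF PQ])
  qed
  note conv_ints = conv_int[OF int'(1) int(3) s(1)] conv_int[OF int(2) int'(3) s(1)]
    conv_int[OF int'(1) int(4) s(2)] conv_int[OF int(2) int'(2) s(2)]
  note conv_eqs = conv_eq[OF int'(1) int(3) s(1)] conv_eq[OF int(2) int'(3) s(1)]
    conv_eq[OF int'(1) int(4) s(2)] conv_eq[OF int(2) int'(2) s(2)]
  have cPQ: "integrable lebesgue ?cP" "integrable lebesgue ?cQ"
    using conv_ints by (auto intro!: integrable_mult_right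
        Bochner_Integration.integrable_add Bochner_Integration.integrable_diff)
  have S_int: "integrable lebesgue (\<lambda>z. ?S (?cP z) (?cQ z))"
    by (rule integrable_symplectic[OF cPQ])
  \<comment> \<open>Almost everywhere equality suffices because \<open>lebesgue\<close> is
    complete.\<close>
  have T_meas: "T \<in> borel_measurable lebesgue"
    by (rule borel_measurable_AE[OF borel_measurable_integrable[OF S_int] T_AE])
  have "?lhs = integral\<^sup>L lebesgue T"
    by (simp add: qlct_def T_def case_prod_beta')
  also have "\<dots> = (\<integral>z. ?S (?cP z) (?cQ z) \<partial>lebesgue)"
    by (rule integral_cong_AE[OF borel_measurable_integrable[OF S_int] T_meas T_AE, symmetric])
  also have "\<dots> = ?S (integral\<^sup>L lebesgue ?cP) (integral\<^sup>L lebesgue ?cQ)"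
    by (rule integral_symplectic[OF cPQ])
  finally have "?lhs = ?S (integral\<^sup>L lebesgue ?cP) (integral\<^sup>L lebesgue ?cQ)" .
  note lhs = this
  have cP: "integral\<^sup>L lebesgue ?cP =
      e * (integral\<^sup>L lebesgue (?I id (\<lambda>z. cnj (\<alpha> z))) * integral\<^sup>L lebesgue (?J id \<gamma>) +
        integral\<^sup>L lebesgue (?I id \<beta>) * integral\<^sup>L lebesgue (?J id (\<lambda>z. cnj (\<delta> z))))"
    by (simp only: integral_mult_right_zero Bochner_Integration.integral_add[OF conv_ints(1,2)] conv_eqs)
  have cQ: "integral\<^sup>L lebesgue ?cQ =
      e' * (integral\<^sup>L lebesgue (?I cnj (\<lambda>z. cnj (\<alpha> z))) * integral\<^sup>L lebesgue (?J cnj \<delta>) -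
        integral\<^sup>L lebesgue (?I cnj \<beta>) * integral\<^sup>L lebesgue (?J cnj (\<lambda>z. cnj (\<gamma> z))))"
    by (simp only: integral_mult_right_zero Bochner_Integration.integral_diff[OF conv_ints(3,4)] conv_eqs)
  \<comment> \<open>Reversing the difference gives the minus sign in front of the \<open>qnu\<close>
    component.\<close>
  have *: "?S p (c * (x - y)) = Hmu_of_complex p - Hmu_of_complex (c * (y - x)) * qnu" for p c x y
    by (simp add: algebra_simps Hmu_of_complex_diff)
  show ?thesis
    unfolding lhs cP cQ * unfolding e_def e'_def ..
qed

section \<open>Return to quaternion-valued functions\<close>

lemma Lspace_integrable: "g \<in> Lspace 1 \<Longrightarrow> integrable lebesgue g"
  by (rule integrable_norm_cancel) (simp_all add: Lspace_def)

theorem theorem7: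
  fixes A1 A2 :: "real^2^2"
    and p :: nat
    and f g fa fb ga gb :: "real \<times> real \<Rightarrow> quat"
  assumes "det A1 = 1" and "A1$1$2 \<noteq> 0"
    and "det A2 = 1" and "A2$1$2 \<noteq> 0"
    and "p \<ge> 1"
    and "f \<in> Lspace 1 \<inter> Lspace p" and "g \<in> Lspace 1"
    and "\<And>z. fa z \<in> Hmu" and "\<And>z. fb z \<in> Hmu" and "\<And>z. f z = fa z + qnu * qcnj (fb z)"
    and "\<And>z. ga z \<in> Hmu" and "\<And>z. gb z \<in> Hmu" and "\<And>z. g z = ga z + qnu * qcnj (gb z)"
  shows "\<forall>u v.
    qlct qmu qmu A1 A2 (qcorr A1 A2 f g) (u, v) =
      exp (- qmu * of_real (A1$2$2 / (2 * A1$1$2) * u\<^sup>2 + A2$2$2 / (2 * A2$1$2) * v\<^sup>2)) *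
        (qlct qmu qmu A1 A2 (\<lambda>z. qcnj (fa z)) (- u, - v) * qlct qmu qmu A1 A2 ga (u, v)
         + qlct qmu qmu A1 A2 fb (- u, - v) * qlct qmu qmu A1 A2 (\<lambda>z. qcnj (gb z)) (u, v))
      - exp (- qmu * of_real (A1$2$2 / (2 * A1$1$2) * u\<^sup>2 - A2$2$2 / (2 * A2$1$2) * v\<^sup>2)) *
        (qlct qmu (- qmu) A1 A2 fb (- u, - v) * qlct qmu (- qmu) A1 A2 (\<lambda>z. qcnj (ga z)) (u, v)
         - qlct qmu (- qmu) A1 A2 (\<lambda>z. qcnj (fa z)) (- u, - v) * qlct qmu (- qmu) A1 A2 gb (u, v))
        * qnu
    \<and> qlct qmu qmu A1 A2 (qcorr A1 A2 f g) (u, v) =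
      (qlct qmu qmu (half_mat A1) (half_mat A2) (\<lambda>z. qcnj (fa z)) (- u, - v)
         * qlct qmu qmu (half_mat A1) (half_mat A2) ga (u, v)
       + qlct qmu qmu (half_mat A1) (half_mat A2) fb (- u, - v)
         * qlct qmu qmu (half_mat A1) (half_mat A2) (\<lambda>z. qcnj (gb z)) (u, v))
      - (qlct qmu (- qmu) (half_mat A1) (half_mat A2) fb (- u, - v)
           * qlct qmu (- qmu) (half_mat A1) (half_mat A2) (\<lambda>z. qcnj (ga z)) (u, v)
         - qlct qmu (- qmu) (half_mat A1) (half_mat A2) (\<lambda>z. qcnj (fa z)) (- u, - v)
           * qlct qmu (- qmu) (half_mat A1) (half_mat A2) gb (u, v))
        * qnu"
proof (intro allI)
  fix u v :: real
  let ?cplx = "\<lambda>h z. Complex (re_part (h z)) (mu_part (h z))"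
  define \<alpha> \<beta> \<gamma> \<delta> where abcd: "\<alpha> = ?cplx fa" "\<beta> = ?cplx fb" "\<gamma> = ?cplx ga" "\<delta> = ?cplx gb"
  have "q = Hmu_of_complex (Complex (re_part q) (mu_part q))" if "q \<in> Hmu" for q
    using that by (auto simp: Hmu_eq_range)
  then have eqs: "fa = (\<lambda>z. Hmu_of_complex (\<alpha> z))" "fb = (\<lambda>z. Hmu_of_complex (\<beta> z))"
    "ga = (\<lambda>z. Hmu_of_complex (\<gamma> z))" "gb = (\<lambda>z. Hmu_of_complex (\<delta> z))"
    unfolding abcd using assms(8,9,11,12) by blast+
  have fg: "f = (\<lambda>z. Hmu_of_complex (\<alpha> z) + qnu * qcnj (Hmu_of_complex (\<beta> z)))"
    "g = (\<lambda>z. Hmu_of_complex (\<gamma> z) + qnu * qcnj (Hmu_of_complex (\<delta> z)))"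
    using assms(10,13) by (auto simp: eqs)
  have lin: "bounded_linear (\<lambda>q. Complex (re_part q) (mu_part q))"
    "bounded_linear (\<lambda>q. Complex (nu_part q) (eta_part q))"
    by (intro linear_conv_bounded_linear[THEN iffD1] linearI; simp add: complex_eq_iff)+
  \<comment> \<open>Neither measurability nor integrability of the components is among the
    hypotheses. Both follow because the components are bounded linear images of \<open>f\<close> and
    \<open>g\<close>.\<close>
  have "\<alpha> = (\<lambda>z. Complex (re_part (f z)) (mu_part (f z)))"
    "\<beta> = (\<lambda>z. Complex (nu_part (f z)) (eta_part (f z)))"
    "\<gamma> = (\<lambda>z. Complex (re_part (g z)) (mu_part (g z)))"
    "\<delta> = (\<lambda>z. Complex (nu_part (g z)) (eta_part (g z)))"
    by (simp_all add: fg qnu_def)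
  moreover have "integrable lebesgue f" "integrable lebesgue g"
    using assms(6,7) by (auto intro: Lspace_integrable)
  ultimately have int: "integrable lebesgue \<alpha>" "integrable lebesgue \<beta>"
    "integrable lebesgue \<gamma>" "integrable lebesgue \<delta>"
    using lin[THEN integrable_bounded_linear] by auto
  then have int': "integrable lebesgue (\<lambda>z. cnj (\<alpha> z))" "integrable lebesgue (\<lambda>z. cnj (\<gamma> z))"
    "integrable lebesgue (\<lambda>z. cnj (\<delta> z))"
    by simp_all
  have b: "A1$1$2 \<noteq> 0" "A2$1$2 \<noteq> 0" "half_mat A2 $ 1 $ 2 \<noteq> 0"
    using assms(2,4) by (simp_all add: half_mat_nth)
  \<comment> \<open>The minus sign before the v^2 term conjugates the second chirp.\<close>
  have chirp: "exp (- qmu * of_real (A1$2$2 / (2 * A1$1$2) * u\<^sup>2 + A2$2$2 / (2 * A2$1$2) * v\<^sup>2)) =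
      Hmu_of_complex (cchirp A1 u * cchirp A2 v)"
    "exp (- qmu * of_real (A1$2$2 / (2 * A1$1$2) * u\<^sup>2 - A2$2$2 / (2 * A2$1$2) * v\<^sup>2)) =
      Hmu_of_complex (cchirp A1 u * cnj (cchirp A2 v))"
    unfolding exp_minus_qmu by (simp_all add: cchirp_def exp_cnj mult_exp_exp algebra_simps)
  obtain e1 where e1: "\<And>x. clct (half_mat A1) x u = e1 * clct A1 x u"
    "\<And>x. clct (half_mat A1) x (- u) = e1 * clct A1 x (- u)" "e1 * e1 = cchirp A1 u"
    using clct_half_mat[OF b(1), of u] by blast
  obtain e2 where e2: "\<And>x. clct (half_mat A2) x v = e2 * clct A2 x v"
    "\<And>x. clct (half_mat A2) x (- v) = e2 * clct A2 x (- v)" "e2 * e2 = cchirp A2 v"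
    using clct_half_mat[OF b(2), of v] by blast
  have half: "clct_integral id (half_mat A1) (half_mat A2) u v h = e1 * e2 * clct_integral id A1 A2 u v h"
    "clct_integral id (half_mat A1) (half_mat A2) (- u) (- v) h =
      e1 * e2 * clct_integral id A1 A2 (- u) (- v) h"
    "clct_integral cnj (half_mat A1) (half_mat A2) u v h = e1 * cnj e2 * clct_integral cnj A1 A2 u v h"
    "clct_integral cnj (half_mat A1) (half_mat A2) (- u) (- v) h =
      e1 * cnj e2 * clct_integral cnj A1 A2 (- u) (- v) h" for h
    by (rule clct_integral_scale; simp add: e1 e2)+
  let ?h = "\<lambda>s. clct_integral s A1 A2"
  let ?main = "Hmu_of_complex (cchirp A1 u * cchirp A2 v *
      (?h id (- u) (- v) (\<lambda>z. cnj (\<alpha> z)) * ?h id u v \<gamma> +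
       ?h id (- u) (- v) \<beta> * ?h id u v (\<lambda>z. cnj (\<delta> z)))) -
    Hmu_of_complex (cchirp A1 u * cnj (cchirp A2 v) *
      (?h cnj (- u) (- v) \<beta> * ?h cnj u v (\<lambda>z. cnj (\<gamma> z)) -
       ?h cnj (- u) (- v) (\<lambda>z. cnj (\<alpha> z)) * ?h cnj u v \<delta>)) * qnu"
  note qlct_eqs = qlct_qmu_qmu qlct_qmu_minus_qmu int int' b
  \<comment> \<open>Each product of two transforms for the halved matrices collects
    \<open>e1\<close> twice together with \<open>e2\<close>, or its conjugate, twice; these squares
    are exactly the chirps.\<close>
  have halves: "Hmu_of_complex
        (e1 * e2 * ?h id (- u) (- v) (\<lambda>z. cnj (\<alpha> z)) * (e1 * e2 * ?h id u v \<gamma>) +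
         e1 * e2 * ?h id (- u) (- v) \<beta> * (e1 * e2 * ?h id u v (\<lambda>z. cnj (\<delta> z)))) -
      Hmu_of_complex
        (e1 * cnj e2 * ?h cnj (- u) (- v) \<beta> * (e1 * cnj e2 * ?h cnj u v (\<lambda>z. cnj (\<gamma> z))) -
         e1 * cnj e2 * ?h cnj (- u) (- v) (\<lambda>z. cnj (\<alpha> z)) * (e1 * cnj e2 * ?h cnj u v \<delta>)) * qnu = ?main"
    unfolding e1(3)[symmetric] e2(3)[symmetric] complex_cnj_mult
    by (intro arg_cong2[where f = "\<lambda>x y. Hmu_of_complex x - Hmu_of_complex y * qnu"])
      (simp_all add: algebra_simps)
  show "qlct qmu qmu A1 A2 (qcorr A1 A2 f g) (u, v) =
      exp (- qmu * of_real (A1$2$2 / (2 * A1$1$2) * u\<^sup>2 + A2$2$2 / (2 * A2$1$2) * v\<^sup>2)) *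
        (qlct qmu qmu A1 A2 (\<lambda>z. qcnj (fa z)) (- u, - v) * qlct qmu qmu A1 A2 ga (u, v)
         + qlct qmu qmu A1 A2 fb (- u, - v) * qlct qmu qmu A1 A2 (\<lambda>z. qcnj (gb z)) (u, v))
      - exp (- qmu * of_real (A1$2$2 / (2 * A1$1$2) * u\<^sup>2 - A2$2$2 / (2 * A2$1$2) * v\<^sup>2)) *
        (qlct qmu (- qmu) A1 A2 fb (- u, - v) * qlct qmu (- qmu) A1 A2 (\<lambda>z. qcnj (ga z)) (u, v)
         - qlct qmu (- qmu) A1 A2 (\<lambda>z. qcnj (fa z)) (- u, - v) * qlct qmu (- qmu) A1 A2 gb (u, v))
        * qnu
    \<and> qlct qmu qmu A1 A2 (qcorr A1 A2 f g) (u, v) =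
      (qlct qmu qmu (half_mat A1) (half_mat A2) (\<lambda>z. qcnj (fa z)) (- u, - v)
         * qlct qmu qmu (half_mat A1) (half_mat A2) ga (u, v)
       + qlct qmu qmu (half_mat A1) (half_mat A2) fb (- u, - v)
         * qlct qmu qmu (half_mat A1) (half_mat A2) (\<lambda>z. qcnj (gb z)) (u, v))
      - (qlct qmu (- qmu) (half_mat A1) (half_mat A2) fb (- u, - v)
           * qlct qmu (- qmu) (half_mat A1) (half_mat A2) (\<lambda>z. qcnj (ga z)) (u, v)
         - qlct qmu (- qmu) (half_mat A1) (half_mat A2) (\<lambda>z. qcnj (fa z)) (- u, - v)
           * qlct qmu (- qmu) (half_mat A1) (half_mat A2) gb (u, v))
        * qnu"
    \<comment> \<open>Both left-hand sides become \<open>?main\<close>. Collecting everything under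
      \<open>Hmu_of_complex\<close> turns the first right-hand side into \<open>?main\<close> and
      the second into the left side of \<open>halves\<close>.\<close>
    unfolding fg qlct_qcorr[OF b(1,2) int]
    unfolding eqs chirp Hmu_of_complex_cnj[symmetric]
    by (simp only: qlct_eqs half not_False_eq_True flip: Hmu_of_complex_mult Hmu_of_complex_add Hmu_of_complex_diff)
       (simp only: halves simp_thms)
qed

end
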